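(* Let $G$ be a finite-dimensional Lie group with Lie algebra $\mathfrak{g}$, let $l_d\colon G\to\mathbb{R}$ be a smooth function (discrete Lagrangian), let $\varphi_d\colon G\to G$ be an arbitrary map, and let $\{w_k\}_{k=0}^{N-1}$ be a sequence of elements of $G$. Then the following conditions are equivalent: (a) The sequence $\{w_k\}_{k=0}^{N-1}$ satisfies the discrete forced Euler--Poincaré equations $$0=\mathcal{R}^*_{w_{k+1}}\, dl_d(w_{k+1})-Ad^*_{\varphi_d(w_k)}\,\mathcal{L}^*_{w_k}\, dl_d(w_k)\qquad\text{for } k=0,\dots,N-2.$$ (b) The discrete generalized variational principle $$\boldsymbol{\delta}\sum_{k=0}^{N-1} l_d(w_k)=0$$ holds for variations of the form $$\boldsymbol{\delta}w_k=-\eta_k w_k+w_k\bigl(Ad_{\varphi_d(w_k)}\eta_{k+1}\bigr),\qquad k=0,\dots,N-1,$$ for any $\{\eta_k\}_{k=0}^{N}\subset\mathfrak{g}$ with $\eta_0=\eta_N=0$.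
   Context: $\mathcal{L}_w$ and $\mathcal{R}_w$ denote left and right multiplication by $w$ on $G$, and $e$ is the identity. For $\eta\in\mathfrak{g}=T_eG$ and $w\in G$, write $w\eta=T_e\mathcal{L}_w(\eta)\in T_wG$ and $\eta w=T_e\mathcal{R}_w(\eta)\in T_wG$. The covectors $\mathcal{L}_w^*dl_d(w),\ \mathcal{R}_w^*dl_d(w)\in\mathfrak{g}^*$ are defined by $\langle\mathcal{L}_w^*dl_d(w),\eta\rangle=\langle dl_d(w),w\eta\rangle$ and $\langle\mathcal{R}_w^*dl_d(w),\eta\rangle=\langle dl_d(w),\eta w\rangle$ for all $\eta\in\mathfrak{g}$. $Ad_g\colon\mathfrak{g}\to\mathfrak{g}$ is the adjoint action and $Ad_g^*\colon\mathfrak{g}^*\to\mathfrak{g}^*$ is its dual map, $\langle Ad_g^*\mu,\eta\rangle=\langle\mu,Ad_g\eta\rangle$. The discrete generalized variational principle for prescribed variations $\boldsymbol{\delta}w_k\in T_{w_k}G$ means that $\boldsymbol{\delta}\sum_{k=0}^{N-1}l_d(w_k):=\sum_{k=0}^{N-1}\langle dl_d(w_k),\boldsymbol{\delta}w_k\rangle=0$ for every choice of the $\eta_k$ as described. *)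

theory Defs
  imports "HOL-Analysis.Analysis" "HOL-Algebra.Group" "HOL-Library.Function_Algebras"
begin

section \<open>Smooth functions between normed spaces\<close>

text \<open>
  \<open>Ck_on n S f\<close> expresses that \<open>f\<close> is of class \<open>C\<^sup>n\<close> on an open subset \<open>S\<close> of a
  finite-dimensional space. In finite dimension it suffices to ask that the directional
  derivative in each fixed direction be of class \<open>C\<^sup>n\<close>.
\<close>

primrec Ck_on ::
  "nat \<Rightarrow> 'a::real_normed_vector set \<Rightarrow> ('a \<Rightarrow> 'b::real_normed_vector) \<Rightarrow> bool" where
  "Ck_on 0 S f \<longleftrightarrow> continuous_on S f"
| "Ck_on (Suc n) S f \<longleftrightarrow>
     (\<forall>x\<in>S. f differentiable (at x)) \<and> (\<forall>v. Ck_on n S (\<lambda>x. frechet_derivative f (at x) v))"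

definition smooth_on :: "'a::real_normed_vector set \<Rightarrow> ('a \<Rightarrow> 'b::real_normed_vector) \<Rightarrow> bool"
  where "smooth_on S f \<longleftrightarrow> (\<forall>n. Ck_on n S f)"


section \<open>Smooth manifolds\<close>

text \<open>
  A chart is a pair \<open>(U, \<phi>)\<close>; the values of \<open>\<phi>\<close> outside \<open>U\<close> are irrelevant. The model
  space \<open>'e\<close> is an arbitrary finite-dimensional normed space rather than a
  \<open>euclidean_space\<close>, because the latter class excludes dimension \<open>0\<close>, that is, discrete groups.
  The atlas need not be maximal.
\<close>

record ('p, 'e) manifold_data =
  mtop :: "'p topology"
  atlas :: "('p set \<times> ('p \<Rightarrow> 'e)) set"

locale smooth_manifold =
  fixes M :: "('p, 'e::real_normed_vector) manifold_data"
  assumes finite_dim: "\<exists>B::'e set. finite B \<and> span B = UNIV"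
    and Hausdorff: "Hausdorff_space (mtop M)"
    and second_countable: "second_countable (mtop M)"
    and chart_open: "\<And>U \<phi>. (U, \<phi>) \<in> atlas M \<Longrightarrow> openin (mtop M) U \<and> open (\<phi> ` U)"
    and chart_homeo: "\<And>U \<phi>. (U, \<phi>) \<in> atlas M \<Longrightarrow>
          homeomorphic_map (subtopology (mtop M) U) (top_of_set (\<phi> ` U)) \<phi>"
    and charts_cover: "(\<Union>(U, \<phi>)\<in>atlas M. U) = topspace (mtop M)"
    and charts_compatible: "\<And>U \<phi> V \<psi>. (U, \<phi>) \<in> atlas M \<Longrightarrow> (V, \<psi>) \<in> atlas M \<Longrightarrow>
          smooth_on (\<phi> ` (U \<inter> V)) (\<psi> \<circ> inv_into U \<phi>)"

definition smooth_map ::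
  "('p, 'e::real_normed_vector) manifold_data \<Rightarrow> ('q, 'f::real_normed_vector) manifold_data \<Rightarrow>
   ('p \<Rightarrow> 'q) \<Rightarrow> bool" where
  "smooth_map M N F \<longleftrightarrow>
     continuous_map (mtop M) (mtop N) F \<and>
     (\<forall>(U, \<phi>)\<in>atlas M. \<forall>(V, \<psi>)\<in>atlas N.
        smooth_on (\<phi> ` (U \<inter> F -` V)) (\<psi> \<circ> F \<circ> inv_into U \<phi>))"

definition prod_manifold ::
  "('p, 'e) manifold_data \<Rightarrow> ('q, 'f) manifold_data \<Rightarrow> ('p \<times> 'q, 'e \<times> 'f) manifold_data" where
  "prod_manifold M N =
     \<lparr>mtop = prod_topology (mtop M) (mtop N),
      atlas = {(U \<times> V, map_prod \<phi> \<psi>) | U \<phi> V \<psi>. (U, \<phi>) \<in> atlas M \<and> (V, \<psi>) \<in> atlas N}\<rparr>"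

definition real_line :: "(real, real) manifold_data" where
  "real_line = \<lparr>mtop = euclideanreal, atlas = {(UNIV, id)}\<rparr>"

definition smooth_funs :: "('p, 'e::real_normed_vector) manifold_data \<Rightarrow> ('p \<Rightarrow> real) set" where
  "smooth_funs M = {f. smooth_map M real_line f}"


section \<open>Tangent vectors and differentials\<close>

text \<open>
  Tangent vectors at \<open>p\<close> are the derivations at \<open>p\<close> of the algebra of smooth functions.
  They are set to \<open>0\<close> on non-smooth arguments, so that the vector space structure of the
  tangent space is the pointwise one of \<^theory>\<open>HOL-Library.Function_Algebras\<close>. The Leibniz
  rule forces a derivation to ignore the values of a function outside the manifold.
\<close>

type_synonym 'p tvec = "('p \<Rightarrow> real) \<Rightarrow> real"

definition tangent_space ::
  "('p, 'e::real_normed_vector) manifold_data \<Rightarrow> 'p \<Rightarrow> 'p tvec set" where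
  "tangent_space M p = {D.
     (\<forall>f\<in>smooth_funs M. \<forall>g\<in>smooth_funs M. D (f + g) = D f + D g) \<and>
     (\<forall>c. \<forall>f\<in>smooth_funs M. D (\<lambda>x. c * f x) = c * D f) \<and>
     (\<forall>f\<in>smooth_funs M. \<forall>g\<in>smooth_funs M. D (f * g) = f p * D g + g p * D f) \<and>
     (\<forall>f. f \<notin> smooth_funs M \<longrightarrow> D f = 0)}"

text \<open>
  The tangent map sends \<open>v\<close> to the derivation \<open>f \<mapsto> v (f \<circ> F)\<close>, and the covector \<open>df(p)\<close>
  sends \<open>v\<close> to \<open>v f\<close>. Neither formula mentions the base point \<open>p\<close>, which enters only through
  the tangent space to which \<open>v\<close> belongs. A covector at \<open>p\<close> is represented by a function on
  \<open>'p tvec\<close> of which only the restriction to the tangent space at \<open>p\<close> is meaningful, so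
  equality of covectors has to be stated as equality on that tangent space.
\<close>

definition tangent_map ::
  "('q, 'f::real_normed_vector) manifold_data \<Rightarrow> ('p \<Rightarrow> 'q) \<Rightarrow> 'p tvec \<Rightarrow> 'q tvec" where
  "tangent_map N F v = (\<lambda>f. if f \<in> smooth_funs N then v (f \<circ> F) else 0)"

type_synonym 'p covec = "'p tvec \<Rightarrow> real"

definition differential :: "('p \<Rightarrow> real) \<Rightarrow> 'p \<Rightarrow> 'p covec" where
  "differential f p = (\<lambda>v. v f)"


section \<open>Lie groups\<close>

record ('g, 'e) lie_group_data = "'g monoid" +
  mfd :: "('g, 'e) manifold_data"

locale lie_group = group G + smooth_manifold "mfd G"
  for G :: "('g, 'e::real_normed_vector) lie_group_data" (structure) +
  assumes carrier_eq: "topspace (mtop (mfd G)) = carrier G"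
    and smooth_mult: "smooth_map (prod_manifold (mfd G) (mfd G)) (mfd G) (\<lambda>(x, y). x \<otimes> y)"
    and smooth_inv: "smooth_map (mfd G) (mfd G) (\<lambda>x. inv x)"

definition lie_algebra :: "('g, 'e::real_normed_vector) lie_group_data \<Rightarrow> 'g tvec set" where
  "lie_algebra G = tangent_space (mfd G) \<one>\<^bsub>G\<^esub>"

text \<open>\<open>left_tr G w \<eta>\<close> is \<open>w\<eta>\<close> and \<open>right_tr G w \<eta>\<close> is \<open>\<eta>w\<close>.\<close>

definition left_tr ::
  "('g, 'e::real_normed_vector) lie_group_data \<Rightarrow> 'g \<Rightarrow> 'g tvec \<Rightarrow> 'g tvec" where
  "left_tr G w \<eta> = tangent_map (mfd G) (\<lambda>x. w \<otimes>\<^bsub>G\<^esub> x) \<eta>"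

definition right_tr ::
  "('g, 'e::real_normed_vector) lie_group_data \<Rightarrow> 'g \<Rightarrow> 'g tvec \<Rightarrow> 'g tvec" where
  "right_tr G w \<eta> = tangent_map (mfd G) (\<lambda>x. x \<otimes>\<^bsub>G\<^esub> w) \<eta>"

definition Ad ::
  "('g, 'e::real_normed_vector) lie_group_data \<Rightarrow> 'g \<Rightarrow> 'g tvec \<Rightarrow> 'g tvec" where
  "Ad G g \<eta> = tangent_map (mfd G) (\<lambda>x. g \<otimes>\<^bsub>G\<^esub> x \<otimes>\<^bsub>G\<^esub> inv\<^bsub>G\<^esub> g) \<eta>"

text \<open>Pullbacks of covectors at \<open>w\<close> to the dual of the Lie algebra, and the dual map of \<open>Ad\<close>.\<close>

definition left_pullback ::
  "('g, 'e::real_normed_vector) lie_group_data \<Rightarrow> 'g \<Rightarrow> 'g covec \<Rightarrow> 'g covec" where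
  "left_pullback G w \<mu> = (\<lambda>\<eta>. \<mu> (left_tr G w \<eta>))"

definition right_pullback ::
  "('g, 'e::real_normed_vector) lie_group_data \<Rightarrow> 'g \<Rightarrow> 'g covec \<Rightarrow> 'g covec" where
  "right_pullback G w \<mu> = (\<lambda>\<eta>. \<mu> (right_tr G w \<eta>))"

definition Ad_dual ::
  "('g, 'e::real_normed_vector) lie_group_data \<Rightarrow> 'g \<Rightarrow> 'g covec \<Rightarrow> 'g covec" where
  "Ad_dual G g \<mu> = (\<lambda>\<eta>. \<mu> (Ad G g \<eta>))"

end

theory Submission
  imports Defs
begin

text \<open>
  Pairing \<open>dl(w\<^sub>k)\<close> with the prescribed variation gives \<open>- a\<^sub>k(\<eta>\<^sub>k) + b\<^sub>k(\<eta>\<^sub>k\<^sub>+\<^sub>1)\<close>, where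
  \<open>a\<^sub>k\<close> is the pullback of \<open>dl(w\<^sub>k)\<close> along right translation by \<open>w\<^sub>k\<close>, and \<open>b\<^sub>k\<close> is its
  pullback along left translation by \<open>w\<^sub>k\<close> followed by the dual of
  \<open>Ad\<close> at \<open>\<phi>(w\<^sub>k)\<close>. The discrete Euler--Poincare equations say \<open>a\<^sub>k\<^sub>+\<^sub>1 = b\<^sub>k\<close> on the Lie
  algebra. Summation by parts collects the two terms in which each \<open>\<eta>\<^sub>k\<^sub>+\<^sub>1\<close> occurs, and the
  boundary terms vanish because \<open>\<eta>\<^sub>0 = \<eta>\<^sub>N = 0\<close>
  (\<open>sum_by_parts_vanishing_ends\<close>). As the inner \<open>\<eta>\<^sub>k\<close> are arbitrary and independent, the sum
  vanishes for all of them exactly when every coefficient \<open>b\<^sub>k - a\<^sub>k\<^sub>+\<^sub>1\<close> does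
  (\<open>discrete_fundamental_lemma\<close>).
\<close>

lemma sum_by_parts_vanishing_ends:
  fixes a b :: "nat \<Rightarrow> 'v::zero \<Rightarrow> real" and \<eta> :: "nat \<Rightarrow> 'v"
  assumes "\<And>k. a k 0 = 0" "\<And>k. b k 0 = 0" "\<eta> 0 = 0" "\<eta> N = 0"
  shows "(\<Sum>k<N. - a k (\<eta> k) + b k (\<eta> (k + 1))) =
         (\<Sum>k<N - 1. b k (\<eta> (k + 1)) - a (k + 1) (\<eta> (k + 1)))"
proof (cases N)
  case 0
  then show ?thesis by simp
next
  case (Suc M)
  have "(\<Sum>k<N. a k (\<eta> k)) = (\<Sum>k<M. a (k + 1) (\<eta> (k + 1)))"
    using assms unfolding Suc by (subst sum.lessThan_Suc_shift) simp
  moreover have "(\<Sum>k<N. b k (\<eta> (k + 1))) = (\<Sum>k<M. b k (\<eta> (k + 1)))"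
    using assms unfolding Suc by simp
  ultimately show ?thesis
    using Suc by (simp add: sum.distrib sum_subtractf sum_negf)
qed

text \<open>
  The discrete counterpart of the fundamental lemma of the calculus of variations. A variation
  concentrated at the single index \<open>k + 1\<close> isolates the \<open>k\<close>-th coefficient; it is admissible
  because \<open>0 \<in> T\<close>, and both endpoints avoid \<open>k + 1\<close> because \<open>0 < k + 1 < N\<close>.
\<close>

lemma discrete_fundamental_lemma:
  fixes a b :: "nat \<Rightarrow> 'v::zero \<Rightarrow> real"
  assumes zero: "\<And>k. a k 0 = 0" "\<And>k. b k 0 = 0" and T: "0 \<in> T"
  shows "(\<forall>k. k + 1 < N \<longrightarrow> (\<forall>\<xi>\<in>T. a (k + 1) \<xi> = b k \<xi>)) \<longleftrightarrow>
         (\<forall>\<eta>. (\<forall>k\<le>N. \<eta> k \<in> T) \<and> \<eta> 0 = 0 \<and> \<eta> N = 0 \<longrightarrow>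
            (\<Sum>k<N. - a k (\<eta> k) + b k (\<eta> (k + 1))) = 0)"
    (is "?eqs \<longleftrightarrow> ?var")
proof
  assume eqs: ?eqs
  show ?var
  proof (intro allI impI)
    fix \<eta> :: "nat \<Rightarrow> 'v"
    assume \<eta>: "(\<forall>k\<le>N. \<eta> k \<in> T) \<and> \<eta> 0 = 0 \<and> \<eta> N = 0"
    have "(\<Sum>k<N - 1. b k (\<eta> (k + 1)) - a (k + 1) (\<eta> (k + 1))) = 0"
      using eqs \<eta> by (intro sum.neutral) auto
    then show "(\<Sum>k<N. - a k (\<eta> k) + b k (\<eta> (k + 1))) = 0"
      using sum_by_parts_vanishing_ends[of a b \<eta> N] zero \<eta> by simp
  qed
next
  assume var: ?var
  show ?eqs
  proof (intro allI impI ballI)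
    fix k \<xi>
    assume k: "k + 1 < N" and \<xi>: "\<xi> \<in> T"
    define \<eta> where "\<eta> = (\<lambda>j. if j = k + 1 then \<xi> else 0)"
    have ends: "\<eta> 0 = 0" "\<eta> N = 0"
      using k by (auto simp: \<eta>_def)
    have "\<forall>j\<le>N. \<eta> j \<in> T"
      using \<xi> T by (simp add: \<eta>_def)
    then have "0 = (\<Sum>j<N. - a j (\<eta> j) + b j (\<eta> (j + 1)))"
      using var ends by metis
    also have "\<dots> = (\<Sum>j<N - 1. b j (\<eta> (j + 1)) - a (j + 1) (\<eta> (j + 1)))"
      using zero ends by (rule sum_by_parts_vanishing_ends)
    also have "\<dots> = (\<Sum>j<N - 1. if j = k then b k \<xi> - a (k + 1) \<xi> else 0)"
      using zero by (intro sum.cong) (auto simp: \<eta>_def)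
    also have "\<dots> = b k \<xi> - a (k + 1) \<xi>"
      using k less_diff_conv[of k N 1] by simp
    finally show "a (k + 1) \<xi> = b k \<xi>" by simp
  qed
qed

lemma tangent_map_zero [simp]: "tangent_map N F 0 = 0"
  by (simp add: tangent_map_def fun_eq_iff)

lemma zero_in_lie_algebra: "0 \<in> lie_algebra G"
  by (simp add: lie_algebra_def tangent_space_def)

theorem theorem4p3:
  fixes G :: "('g, 'e::real_normed_vector) lie_group_data"
    and l :: "'g \<Rightarrow> real" and \<phi> :: "'g \<Rightarrow> 'g" and w :: "nat \<Rightarrow> 'g" and N :: nat
  assumes "lie_group G"
    and "l \<in> smooth_funs (mfd G)"
    and "\<phi> \<in> carrier G \<rightarrow> carrier G"
    and "\<And>k. k < N \<Longrightarrow> w k \<in> carrier G"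
  shows
    "(\<forall>k. k + 1 < N \<longrightarrow>
        (\<forall>\<xi>\<in>lie_algebra G.
           0 = (right_pullback G (w (k + 1)) (differential l (w (k + 1)))
                 - Ad_dual G (\<phi> (w k)) (left_pullback G (w k) (differential l (w k)))) \<xi>))
     \<longleftrightarrow>
     (\<forall>\<eta> :: nat \<Rightarrow> 'g tvec.
        (\<forall>k\<le>N. \<eta> k \<in> lie_algebra G) \<and> \<eta> 0 = 0 \<and> \<eta> N = 0 \<longrightarrow>
        (\<Sum>k<N. differential l (w k)
           (- right_tr G (w k) (\<eta> k) + left_tr G (w k) (Ad G (\<phi> (w k)) (\<eta> (k + 1))))) = 0)"
proof -
  define a where "a = (\<lambda>k. right_pullback G (w k) (differential l (w k)))"
  define b where "b = (\<lambda>k. Ad_dual G (\<phi> (w k)) (left_pullback G (w k) (differential l (w k))))"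
  have a0: "a k 0 = 0" for k
    by (simp add: a_def right_pullback_def right_tr_def differential_def)
  have b0: "b k 0 = 0" for k
    by (simp add: b_def Ad_dual_def left_pullback_def left_tr_def Ad_def differential_def)
  have variation: "differential l (w k)
        (- right_tr G (w k) \<xi> + left_tr G (w k) (Ad G (\<phi> (w k)) \<zeta>)) = - a k \<xi> + b k \<zeta>" for k \<xi> \<zeta>
    by (simp add: a_def b_def right_pullback_def Ad_dual_def left_pullback_def differential_def)
  have equation: "0 = (a (k + 1) - b k) \<xi> \<longleftrightarrow> a (k + 1) \<xi> = b k \<xi>" for k \<xi>
    by auto
  show ?thesis
    using discrete_fundamental_lemma[of a b "lie_algebra G" N, OF a0 b0 zero_in_lie_algebra]
    unfolding variation equation[unfolded a_def b_def] by (simp only: a_def b_def)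
qed

end
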